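(* There exist digraphs $F_1, F_2, \dots$ such that: (i) $\vec{\chi}(F_n) \to \infty$ as $n \to \infty$; (ii) for every $n \geq 1$ and every $v \in V(F_n)$, the neighbourhood $N(v)$ of $v$ in $F_n$ can be partitioned into four sets each inducing a tournament; and (iii) for every $n \geq 1$, $F_n$ contains no cyclic triangle, i.e., no three vertices $u,v,w$ with arcs $uv, vw, wu$.
   Context: All digraphs are finite, loopless, and between any two distinct vertices at most one of the two possible arcs is present. The dichromatic number $\vec{\chi}(D)$ is the least $k$ such that $V(D)$ can be partitioned into $k$ sets each inducing an acyclic subdigraph. The neighbourhood $N(v)$ is the set of vertices $u\ne v$ such that $uv$ or $vu$ is an arc. A tournament is a digraph in which every two distinct vertices are joined by exactly one arc. *)

theory Defs
  imports "Graph_Theory.Graph_Theory" "HOL-Library.Disjoint_Sets"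
begin

locale oriented_digraph = digraph +
  assumes at_most_one_arc: "u \<rightarrow> v \<Longrightarrow> \<not> v \<rightarrow> u"

locale tournament = oriented_digraph +
  assumes arc_between:
    "\<lbrakk>u \<in> verts G; v \<in> verts G; u \<noteq> v\<rbrakk> \<Longrightarrow> u \<rightarrow> v \<or> v \<rightarrow> u"

definition acyclic_digraph :: "('a, 'b) pre_digraph \<Rightarrow> bool" where
  "acyclic_digraph G \<longleftrightarrow> \<not> (\<exists>p. pre_digraph.cycle G p)"

text \<open>Parts are indexed by \<open>{..<k}\<close> and may be empty.\<close>

definition partitionable_into :: "nat \<Rightarrow> ('a set \<Rightarrow> bool) \<Rightarrow> 'a set \<Rightarrow> bool" where
  "partitionable_into k P A \<longleftrightarrow>
     (\<exists>X :: nat \<Rightarrow> 'a set.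
        disjoint_family_on X {..<k} \<and> (\<Union>i<k. X i) = A \<and> (\<forall>i<k. P (X i)))"

definition dichromatic_number :: "('a, 'b) pre_digraph \<Rightarrow> nat" where
  "dichromatic_number G =
     (LEAST k. partitionable_into k (\<lambda>S. acyclic_digraph (G \<restriction> S)) (verts G))"

definition neighbourhood :: "('a, 'b) pre_digraph \<Rightarrow> 'a \<Rightarrow> 'a set" where
  "neighbourhood G v =
     {u \<in> verts G. u \<noteq> v \<and> (u \<rightarrow>\<^bsub>G\<^esub> v \<or> v \<rightarrow>\<^bsub>G\<^esub> u)}"

text \<open>In a loopless digraph the three vertices below are automatically distinct.\<close>

definition has_cyclic_triangle :: "('a, 'b) pre_digraph \<Rightarrow> bool" where
  "has_cyclic_triangle G \<longleftrightarrow>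
     (\<exists>u\<in>verts G. \<exists>v\<in>verts G. \<exists>w\<in>verts G.
        u \<rightarrow>\<^bsub>G\<^esub> v \<and> v \<rightarrow>\<^bsub>G\<^esub> w \<and> w \<rightarrow>\<^bsub>G\<^esub> u)"

end

(* On a finite set W of points of R^3, draw an arc from p to p + t d for every t > 0 and every d among
   (1,0,0), (0,1,0), (0,0,1), (-1,-1,-1).  The neighbours of a point lie on four lines through it, and
   the points of W on one line form a transitive tournament.  Any three of the directions are linearly
   independent, so a nonnegative combination of at most three arcs vanishes only trivially and there
   is no cyclic triangle.  The four directions sum to zero, so every positive homothetic copy of
   {0, (1,0,0), (1,1,0), (1,1,1)} is a directed 4-cycle.  By Gallai's theorem W can be chosen such that
   every colouring of W with k + 1 colours makes such a copy monochromatic. *)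
theory Submission
  imports Defs "HOL-Analysis.Product_Vector"
begin

section \<open>Gallai's theorem by colour focusing\<close>

text \<open>The witnesses \<open>A\<close> and \<open>T\<close> do not depend on the colouring; this replaces a compactness argument.\<close>

definition homothetic_ramsey :: "'a::real_vector set \<Rightarrow> nat \<Rightarrow> bool" where
  "homothetic_ramsey S k \<longleftrightarrow>
     (\<exists>A T. finite A \<and> finite T \<and> T \<subseteq> {0<..} \<and>
        (\<forall>c :: 'a \<Rightarrow> nat. (\<forall>x. c x < k) \<longrightarrow>
           (\<exists>a\<in>A. \<exists>t\<in>T. \<forall>s\<in>S. \<forall>s'\<in>S. c (a + t *\<^sub>R s) = c (a + t *\<^sub>R s'))))"

text \<open>Colour focusing: each colour in \<open>C\<close> is that of a homothetic copy of \<open>S\<close>, and all these copies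
  are focused at \<open>f\<close>, the point that would complete each of them to a copy of \<open>insert s0 S\<close>. In the
  induction step the translates of a whole focusing configuration \<open>W\<close> are coloured by their colour
  pattern, which takes finitely many values.\<close>

lemma colour_focusing:
  fixes S :: "'a::real_vector set"
  assumes S: "finite S" "S \<noteq> {}" and ramsey: "\<And>k. homothetic_ramsey S k"
  shows "\<exists>Q T. finite Q \<and> finite T \<and> T \<subseteq> {0<..} \<and>
    (\<forall>c :: 'a \<Rightarrow> nat. (\<forall>x. c x < k) \<longrightarrow>
      (\<exists>f\<in>Q. (\<exists>t\<in>T. \<forall>s\<in>S. c (f + t *\<^sub>R (s - s0)) = c f) \<or>
        (\<exists>C\<subseteq>{..<k}. card C = r \<and> (\<forall>j\<in>C. \<exists>t\<in>T. \<forall>s\<in>S. c (f + t *\<^sub>R (s - s0)) = j))))"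
proof (induction r)
  case 0
  show ?case
    \<comment> \<open>With no colours to collect, \<open>C\<close> is empty and any single focus
      will do.\<close>
    by (rule exI[of _ "{0}"], rule exI[of _ "{}"]) auto
next
  case (Suc r)
  obtain Q T where Q: "finite Q" and T: "finite T" "T \<subseteq> {0<..}" and
    focus: "\<And>c :: 'a \<Rightarrow> nat. (\<And>x. c x < k) \<Longrightarrow>
      \<exists>f\<in>Q. (\<exists>t\<in>T. \<forall>s\<in>S. c (f + t *\<^sub>R (s - s0)) = c f) \<or>
        (\<exists>C\<subseteq>{..<k}. card C = r \<and> (\<forall>j\<in>C. \<exists>t\<in>T. \<forall>s\<in>S. c (f + t *\<^sub>R (s - s0)) = j))"
    using Suc.IH by metis
  \<comment> \<open>These are all the points whose colours the focusing statement inspects: the foci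
    and the copies around them.\<close>
  define W where "W = Q \<union> (\<lambda>(f,t,s). f + t *\<^sub>R (s - s0)) ` (Q \<times> T \<times> S)"
  have W_Q: "f \<in> W" if "f \<in> Q" for f
    using that by (simp add: W_def)
  have W_focus: "f + t *\<^sub>R (s - s0) \<in> W" if "f \<in> Q" "t \<in> T" "s \<in> S" for f t s
    using that by (force simp: W_def)
  have "finite W"
    using Q T S by (simp add: W_def)
  then have "finite (W \<rightarrow>\<^sub>E {..<k})"
    by (simp add: finite_PiE)
  \<comment> \<open>Colour patterns on \<open>W\<close> are numbered by \<open>e\<close>, because
    \<open>homothetic_ramsey\<close> speaks of natural numbers as colours.\<close>
  then obtain e :: "('a \<Rightarrow> nat) \<Rightarrow> nat" and K
    where e: "e ` (W \<rightarrow>\<^sub>E {..<k}) = {i. i < K}" "inj_on e (W \<rightarrow>\<^sub>E {..<k})"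
    using finite_imp_inj_to_nat_seg by metis
  obtain A U where A: "finite A" and U: "finite U" "U \<subseteq> {0<..}" and
    A_U: "\<And>c :: 'a \<Rightarrow> nat. (\<And>x. c x < K) \<Longrightarrow>
      \<exists>a\<in>A. \<exists>u\<in>U. \<forall>s\<in>S. \<forall>s'\<in>S. c (a + u *\<^sub>R s) = c (a + u *\<^sub>R s')"
    using ramsey[of K] unfolding homothetic_ramsey_def by metis
  \<comment> \<open>A point of \<open>S\<close> in place of \<open>s\<close> gives a translated old
    focus, which serves if it completes a monochromatic copy; \<open>s0\<close> gives the new
    focus.\<close>
  define Q' where "Q' = (\<lambda>(a,u,s,f). a + u *\<^sub>R s + f) ` (A \<times> U \<times> insert s0 S \<times> Q)"
  \<comment> \<open>Ratios \<open>t\<close> serve the case of a completed copy, \<open>u\<close> the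
    copy in the new colour, and \<open>t + u\<close> the enlarged old copies.\<close>
  define T' where "T' = T \<union> U \<union> (\<lambda>(t,u). t + u) ` (T \<times> U)"
  have "finite Q'" "finite T'"
    using A U Q T S by (simp_all add: Q'_def T'_def)
  moreover have "T' \<subseteq> {0<..}"
    using T U by (force simp: T'_def)
  moreover have "\<exists>f\<in>Q'. (\<exists>t\<in>T'. \<forall>s\<in>S. c (f + t *\<^sub>R (s - s0)) = c f) \<or>
        (\<exists>C\<subseteq>{..<k}. card C = Suc r \<and> (\<forall>j\<in>C. \<exists>t\<in>T'. \<forall>s\<in>S. c (f + t *\<^sub>R (s - s0)) = j))"
    if c: "\<And>x. c x < k" for c :: "'a \<Rightarrow> nat"
  proof -
    define pat where "pat x = restrict (\<lambda>w. c (x + w)) W" for x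
    have pat: "pat x \<in> W \<rightarrow>\<^sub>E {..<k}" for x
      using c by (auto simp: pat_def)
    have "e (pat x) < K" for x
      using e(1) pat[of x] by blast
    from A_U[of "\<lambda>x. e (pat x)", OF this] obtain a u where a: "a \<in> A" and u: "u \<in> U"
      and e_eq: "\<And>s s'. s \<in> S \<Longrightarrow> s' \<in> S \<Longrightarrow> e (pat (a + u *\<^sub>R s)) = e (pat (a + u *\<^sub>R s'))"
      by blast
    \<comment> \<open>Moving the base point along the copy of \<open>S\<close> given by
      \<open>a\<close> and \<open>u\<close> changes no colour of the configuration carried by
      it.\<close>
    have same: "c (a + u *\<^sub>R s + w) = c (a + u *\<^sub>R s' + w)"
      if "s \<in> S" "s' \<in> S" "w \<in> W" for s s' w
    proof -
      have "pat (a + u *\<^sub>R s) = pat (a + u *\<^sub>R s')"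
        using e(2) e_eq[OF that(1,2)] pat by (meson inj_onD)
      then show ?thesis
        using \<open>w \<in> W\<close> by (metis pat_def restrict_apply')
    qed
    obtain s1 where s1: "s1 \<in> S"
      using S by blast
    define b where "b = a + u *\<^sub>R s1"
    \<comment> \<open>The induction hypothesis is applied to the colouring translated by
      \<open>b\<close>.\<close>
    obtain f where f: "f \<in> Q" and
      cases: "(\<exists>t\<in>T. \<forall>s\<in>S. c (b + (f + t *\<^sub>R (s - s0))) = c (b + f)) \<or>
        (\<exists>C\<subseteq>{..<k}. card C = r \<and>
          (\<forall>j\<in>C. \<exists>t\<in>T. \<forall>s\<in>S. c (b + (f + t *\<^sub>R (s - s0))) = j))"
      using focus[of "\<lambda>x. c (b + x)"] c by blast
    have b_f: "b + f \<in> Q'"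
      using a u s1 f by (force simp: Q'_def b_def)
    \<comment> \<open>If the colour of the focus already lies in \<open>C\<close>, then the copy in
      that colour together with the focus gives \<open>mono\<close>; otherwise the focus supplies a
      new colour.\<close>
    consider (mono) t where "t \<in> T" "\<forall>s\<in>S. c (b + (f + t *\<^sub>R (s - s0))) = c (b + f)"
      | (new) C where "C \<subseteq> {..<k}" "card C = r" "c (b + f) \<notin> C"
          "\<forall>j\<in>C. \<exists>t\<in>T. \<forall>s\<in>S. c (b + (f + t *\<^sub>R (s - s0))) = j"
      using cases by metis
    then show ?thesis
    proof cases
      case mono
      then have "t \<in> T'" "\<forall>s\<in>S. c (b + f + t *\<^sub>R (s - s0)) = c (b + f)"
        by (auto simp: T'_def add.assoc)
      then show ?thesis
        using b_f by blast
    next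
      case new
      \<comment> \<open>The common focus moves to the point obtained by replacing \<open>s1\<close>
        with \<open>s0\<close> in the base point.\<close>
      define g where "g = a + u *\<^sub>R s0 + f"
      have "g \<in> Q'"
        using a u f by (force simp: Q'_def g_def)
      moreover have "insert (c (b + f)) C \<subseteq> {..<k}"
        using new c by simp
      moreover have "card (insert (c (b + f)) C) = Suc r"
        using new by (simp add: finite_subset[OF new(1)])
      moreover have "\<exists>t\<in>T'. \<forall>s\<in>S. c (g + t *\<^sub>R (s - s0)) = j"
        if "j \<in> insert (c (b + f)) C" for j
      proof (cases "j = c (b + f)")
        case True
        have "c (g + u *\<^sub>R (s - s0)) = j" if "s \<in> S" for s
        proof -
          have "g + u *\<^sub>R (s - s0) = a + u *\<^sub>R s + f"
            by (simp add: g_def algebra_simps)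
          then show ?thesis
            using same[OF that s1 W_Q[OF f]] True by (simp add: b_def)
        qed
        then show ?thesis
          using u by (auto simp: T'_def)
      next
        case False
        then obtain t where t: "t \<in> T" "\<forall>s\<in>S. c (b + (f + t *\<^sub>R (s - s0))) = j"
          using new \<open>j \<in> insert (c (b + f)) C\<close> by blast
        \<comment> \<open>Diagonal choice: the point belonging to \<open>s\<close> is taken from the
          old copy carried by the base point \<open>a + u *\<^sub>R s\<close>, and
          \<open>same\<close> brings its colour back to that at \<open>b\<close>.\<close>
        have "c (g + (t + u) *\<^sub>R (s - s0)) = j" if "s \<in> S" for s
        proof -
          have "g + (t + u) *\<^sub>R (s - s0) = a + u *\<^sub>R s + (f + t *\<^sub>R (s - s0))"
            by (simp add: g_def algebra_simps)
          then show ?thesis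
            using same[OF that s1 W_focus[OF f t(1) that]] t that by (simp add: b_def)
        qed
        moreover have "t + u \<in> T'"
          using t u by (force simp: T'_def)
        ultimately show ?thesis
          by blast
      qed
      ultimately show ?thesis
        by blast
    qed
  qed
  ultimately show ?case
    by blast
qed

text \<open>Induction adds one point \<open>s0\<close> at a time. Focusing with as many colours as
  are available forces the colour of the focus to be among those collected, so one of the copies is
  completed by its focus.\<close>

theorem gallai:
  fixes S :: "'a::real_vector set"
  assumes "finite S" "S \<noteq> {}"
  shows "homothetic_ramsey S k"
  using assms
proof (induction S arbitrary: k rule: finite_ne_induct)
  case (singleton s)
  show ?case
    unfolding homothetic_ramsey_def
    by (rule exI[of _ "{0}"], rule exI[of _ "{1}"]) auto
next
  case (insert s0 S)
  obtain Q T where Q: "finite Q" and T: "finite T" "T \<subseteq> {0<..}" and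
    focus: "\<And>c :: 'a \<Rightarrow> nat. (\<And>x. c x < k) \<Longrightarrow>
      \<exists>f\<in>Q. (\<exists>t\<in>T. \<forall>s\<in>S. c (f + t *\<^sub>R (s - s0)) = c f) \<or>
        (\<exists>C\<subseteq>{..<k}. card C = k \<and> (\<forall>j\<in>C. \<exists>t\<in>T. \<forall>s\<in>S. c (f + t *\<^sub>R (s - s0)) = j))"
    using colour_focusing[OF insert(1,2,4), of k s0 k] by metis
  \<comment> \<open>The shift by \<open>t *\<^sub>R s0\<close> turns a copy described by its focus
    into one of the form \<open>a + t *\<^sub>R s\<close>.\<close>
  define A where "A = (\<lambda>(f,t). f - t *\<^sub>R s0) ` (Q \<times> T)"
  have "finite A"
    using Q T by (simp add: A_def)
  moreover have "\<exists>a\<in>A. \<exists>t\<in>T. \<forall>s\<in>insert s0 S. \<forall>s'\<in>insert s0 S. c (a + t *\<^sub>R s) = c (a + t *\<^sub>R s')"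
    if c: "\<And>x. c x < k" for c :: "'a \<Rightarrow> nat"
  proof -
    obtain f t where f: "f \<in> Q" and t: "t \<in> T" and mono: "\<And>s. s \<in> S \<Longrightarrow> c (f + t *\<^sub>R (s - s0)) = c f"
    proof -
      obtain f where f: "f \<in> Q" and cases: "(\<exists>t\<in>T. \<forall>s\<in>S. c (f + t *\<^sub>R (s - s0)) = c f) \<or>
        (\<exists>C\<subseteq>{..<k}. card C = k \<and> (\<forall>j\<in>C. \<exists>t\<in>T. \<forall>s\<in>S. c (f + t *\<^sub>R (s - s0)) = j))"
        using focus[of c] c by blast
      from cases have "\<exists>t\<in>T. \<forall>s\<in>S. c (f + t *\<^sub>R (s - s0)) = c f"
      proof (elim disjE exE conjE)
        fix C
        assume C: "C \<subseteq> {..<k}" "card C = k"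
          and all: "\<forall>j\<in>C. \<exists>t\<in>T. \<forall>s\<in>S. c (f + t *\<^sub>R (s - s0)) = j"
        have "C = {..<k}"
          using C by (simp add: card_subset_eq)
        then have "c f \<in> C"
          using c by simp
        with all show ?thesis ..
      qed
      then obtain t where "t \<in> T" "\<forall>s\<in>S. c (f + t *\<^sub>R (s - s0)) = c f" ..
      then show thesis
        using f by (intro that) auto
    qed
    have "c (f - t *\<^sub>R s0 + t *\<^sub>R s) = c f" if "s \<in> insert s0 S" for s
    proof (cases "s = s0")
      case False
      have "f - t *\<^sub>R s0 + t *\<^sub>R s = f + t *\<^sub>R (s - s0)"
        by (simp add: algebra_simps)
      then show ?thesis
        using mono that False by (metis insertE)
    qed simp
    moreover have "f - t *\<^sub>R s0 \<in> A"
      using f t by (force simp: A_def)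
    ultimately show ?thesis
      using t by (intro bexI[of _ "f - t *\<^sub>R s0"] bexI[of _ t]) simp_all
  qed
  ultimately show ?case
    using T unfolding homothetic_ramsey_def by blast
qed

section \<open>Lines and arcs in four directions of R^3\<close>

fun on_line :: "nat \<Rightarrow> real \<times> real \<times> real \<Rightarrow> real \<times> real \<times> real \<Rightarrow> bool" where
  "on_line i (x, y, z) (x', y', z') \<longleftrightarrow>
     (if i = 0 then y' = y \<and> z' = z
      else if i = 1 then x' = x \<and> z' = z
      else if i = 2 then x' = x \<and> y' = y
      else x' - x = y' - y \<and> y' - y = z' - z)"

text \<open>The last disjunct is the direction (-1,-1,-1): all three coordinates drop by the same
  amount.\<close>

fun line_arc :: "real \<times> real \<times> real \<Rightarrow> real \<times> real \<times> real \<Rightarrow> bool" where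
  "line_arc (x, y, z) (x', y', z') \<longleftrightarrow>
     (x < x' \<and> y' = y \<and> z' = z) \<or> (x' = x \<and> y < y' \<and> z' = z) \<or> (x' = x \<and> y' = y \<and> z < z') \<or>
     (x' < x \<and> x' - x = y' - y \<and> y' - y = z' - z)"

lemma line_arc_irrefl: "\<not> line_arc p p"
  by (cases p) auto

lemma line_arc_asym: "line_arc p q \<Longrightarrow> \<not> line_arc q p"
  by (cases p; cases q) auto

lemma line_arc_no_triangle: "line_arc p q \<Longrightarrow> line_arc q r \<Longrightarrow> \<not> line_arc r p"
  by (cases p; cases q; cases r) (simp; argo)

lemma line_arc_imp_on_line: "line_arc p q \<or> line_arc q p \<Longrightarrow> \<exists>i<4. on_line i p q"
proof -
  assume "line_arc p q \<or> line_arc q p"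
  then have "on_line 0 p q \<or> on_line 1 p q \<or> on_line 2 p q \<or> on_line 3 p q"
    by (cases p; cases q) (simp; argo)
  then show ?thesis
    by (elim disjE) (rule exI, erule conjI[rotated], simp)+
qed

text \<open>The directions are pairwise independent, so two different lines through \<open>p\<close>
  meet only there. The last branch of \<open>on_line\<close> catches all indices from 3 on; the
  bounds leave only 3.\<close>

lemma on_line_unique: "on_line i p q \<Longrightarrow> on_line j p q \<Longrightarrow> i < 4 \<Longrightarrow> j < 4 \<Longrightarrow> p \<noteq> q \<Longrightarrow> i = j"
  by (cases p; cases q) (auto split: if_splits)

text \<open>The difference of two points on a line through \<open>p\<close> is a multiple of the
  direction of the line, and its sign orients the arc.\<close>

lemma on_line_total: "on_line i p q \<Longrightarrow> on_line i p q' \<Longrightarrow> q \<noteq> q' \<Longrightarrow> line_arc q q' \<or> line_arc q' q"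
  by (cases p; cases q; cases q') (auto split: if_splits)

lemma on_line_arc: "on_line i p q \<Longrightarrow> p \<noteq> q \<Longrightarrow> line_arc p q \<or> line_arc q p"
  by (cases p; cases q) (auto split: if_splits)

section \<open>The digraph on an enumerated point set\<close>

definition line_digraph :: "(nat \<Rightarrow> real \<times> real \<times> real) \<Rightarrow> nat \<Rightarrow> nat pair_pre_digraph" where
  "line_digraph g N =
     \<lparr> pverts = {..<N}, parcs = {(i, j). i < N \<and> j < N \<and> line_arc (g i) (g j)} \<rparr>"

lemma line_digraph_simps [simp]:
  "pverts (line_digraph g N) = {..<N}"
  "(i, j) \<in> parcs (line_digraph g N) \<longleftrightarrow> i < N \<and> j < N \<and> line_arc (g i) (g j)"
  by (simp_all add: line_digraph_def)

lemma oriented_digraph_line_digraph: "oriented_digraph (with_proj (line_digraph g N))"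
proof -
  have "finite (parcs (line_digraph g N))"
    by (rule finite_subset[of _ "{..<N} \<times> {..<N}"]) auto
  then interpret pair_digraph "line_digraph g N"
    by unfold_locales (auto simp: line_arc_irrefl)
  show ?thesis
    by unfold_locales (auto simp: line_arc_asym)
qed

lemma no_cyclic_triangle_line_digraph: "\<not> has_cyclic_triangle (with_proj (line_digraph g N))"
proof
  assume "has_cyclic_triangle (with_proj (line_digraph g N))"
  then obtain u v w where "line_arc (g u) (g v)" "line_arc (g v) (g w)" "line_arc (g w) (g u)"
    by (auto simp: has_cyclic_triangle_def)
  then show False
    using line_arc_no_triangle by blast
qed

lemma oriented_digraph_induce_subgraph:
  assumes "oriented_digraph G" "S \<subseteq> verts G"
  shows "oriented_digraph (G \<restriction> S)"
proof -
  interpret oriented_digraph G by fact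
  interpret S: digraph "G \<restriction> S"
    using induced_induce[OF assms(2)] by (rule digraphI_induced)
  show ?thesis
    by unfold_locales (meson at_most_one_arc dominates_induce_subgraphD)
qed

text \<open>The parts are the vertices other than \<open>v\<close> on each of the four lines through
  \<open>g v\<close>. Injectivity of \<open>g\<close> turns distinct indices into distinct points,
  which disjointness and the existence of arcs rest on.\<close>

lemma neighbourhood_line_digraph:
  assumes inj: "inj_on g {..<N}" and v: "v < N"
  shows "partitionable_into 4 (\<lambda>S. tournament (with_proj (line_digraph g N) \<restriction> S))
           (neighbourhood (with_proj (line_digraph g N)) v)"
proof -
  define X where "X i = {u. u < N \<and> u \<noteq> v \<and> on_line i (g v) (g u)}" for i
  have ne: "g u \<noteq> g w" if "u < N" "w < N" "u \<noteq> w" for u w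
    using inj that by (auto dest: inj_onD)
  have "disjoint_family_on X {..<4}"
  proof (unfold disjoint_family_on_def, intro ballI impI equals0I)
    fix i j u
    assume "i \<in> {..<4::nat}" "j \<in> {..<4::nat}" "i \<noteq> j" "u \<in> X i \<inter> X j"
    then show False
      using on_line_unique[of i "g v" "g u" j] ne[OF v, of u] by (auto simp: X_def)
  qed
  moreover have "(\<Union>i<4. X i) = neighbourhood (with_proj (line_digraph g N)) v"
  proof (intro set_eqI iffI)
    fix u
    assume "u \<in> (\<Union>i<4. X i)"
    then show "u \<in> neighbourhood (with_proj (line_digraph g N)) v"
      using on_line_arc[of _ "g v" "g u"] ne[OF v, of u] v
      by (auto simp: X_def neighbourhood_def)
  next
    fix u
    assume "u \<in> neighbourhood (with_proj (line_digraph g N)) v"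
    then show "u \<in> (\<Union>i<4. X i)"
      using line_arc_imp_on_line[of "g v" "g u"] by (auto simp: X_def neighbourhood_def)
  qed
  moreover have "tournament (with_proj (line_digraph g N) \<restriction> X i)" for i
  proof -
    have "X i \<subseteq> {..<N}"
      by (auto simp: X_def)
    then interpret oriented_digraph "with_proj (line_digraph g N) \<restriction> X i"
      by (intro oriented_digraph_induce_subgraph oriented_digraph_line_digraph) simp
    show ?thesis
    proof
      fix u w
      assume "u \<in> verts (with_proj (line_digraph g N) \<restriction> X i)"
        "w \<in> verts (with_proj (line_digraph g N) \<restriction> X i)" and "u \<noteq> w"
      then have uw: "u \<in> X i" "w \<in> X i" "u < N" "w < N"
        by (auto simp: X_def)
      then have "line_arc (g u) (g w) \<or> line_arc (g w) (g u)"
        using on_line_total[of i "g v" "g u" "g w"] ne[OF _ _ \<open>u \<noteq> w\<close>] by (auto simp: X_def)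
      then show "u \<rightarrow>\<^bsub>with_proj (line_digraph g N) \<restriction> X i\<^esub> w \<or>
          w \<rightarrow>\<^bsub>with_proj (line_digraph g N) \<restriction> X i\<^esub> u"
        using uw by (auto simp: arcs_ends_conv image_iff)
    qed
  qed
  ultimately show ?thesis
    unfolding partitionable_into_def by blast
qed

section \<open>Lower bound on the dichromatic number\<close>

lemma dichromatic_number_gtI:
  assumes "oriented_digraph G" "verts G = {..<N::nat}"
    and no_partition: "\<And>m. m \<le> k \<Longrightarrow> \<not> partitionable_into m (\<lambda>S. acyclic_digraph (G \<restriction> S)) (verts G)"
  shows "k < dichromatic_number G"
proof -
  interpret oriented_digraph G by fact
  have "acyclic_digraph (G \<restriction> {i})" for i
  proof -
    have no_arcs: "arcs (G \<restriction> {i}) = {}"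
      using no_loops by fastforce
    show ?thesis
      unfolding acyclic_digraph_def pre_digraph.cycle_def pre_digraph.awalk_def no_arcs by simp
  qed
  \<comment> \<open>Singletons give some admissible partition, so the \<open>LEAST\<close> in the
    dichromatic number is attained.\<close>
  then have "partitionable_into N (\<lambda>S. acyclic_digraph (G \<restriction> S)) (verts G)"
    unfolding partitionable_into_def assms(2)
    by (intro exI[of _ "\<lambda>i. {i}"]) (auto simp: disjoint_family_on_def)
  then have "partitionable_into (dichromatic_number G) (\<lambda>S. acyclic_digraph (G \<restriction> S)) (verts G)"
    unfolding dichromatic_number_def by (rule LeastI)
  then show ?thesis
    using no_partition not_le by blast
qed

lemma four_cycle_not_acyclic:
  assumes "distinct [p, q, r, s]" "{p, q, r, s} \<subseteq> S"
    and "(p, q) \<in> parcs G" "(q, r) \<in> parcs G" "(r, s) \<in> parcs G" "(s, p) \<in> parcs G"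
  shows "\<not> acyclic_digraph (with_proj G \<restriction> S)"
proof -
  have "pre_digraph.cycle (with_proj G \<restriction> S) [(p, q), (q, r), (r, s), (s, p)]"
    unfolding pre_digraph.cycle_def pre_digraph.awalk_def
    using assms
    by (intro exI[of _ p]) (auto simp: pre_digraph.cas.simps pre_digraph.awalk_verts.simps)
  then show ?thesis
    by (auto simp: acyclic_digraph_def)
qed

text \<open>The partial sums of the three coordinate directions; a step along (-1,-1,-1) leads from
  the last back to the origin.\<close>

definition quad :: "(real \<times> real \<times> real) set" where
  "quad = {(0, 0, 0), (1, 0, 0), (1, 1, 0), (1, 1, 1)}"

lemma exists_line_digraph:
  "\<exists>g N. inj_on g {..<N} \<and> k < dichromatic_number (with_proj (line_digraph g N))"
proof -
  obtain A T where A: "finite A" and T: "finite T" "T \<subseteq> {0<..}" and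
    A_T: "\<And>c :: real \<times> real \<times> real \<Rightarrow> nat. (\<And>x. c x < Suc k) \<Longrightarrow>
      \<exists>a\<in>A. \<exists>t\<in>T. \<forall>s\<in>quad. \<forall>s'\<in>quad. c (a + t *\<^sub>R s) = c (a + t *\<^sub>R s')"
    using gallai[of quad "Suc k"] unfolding homothetic_ramsey_def quad_def by auto
  define W where "W = (\<lambda>(a, t, s). a + t *\<^sub>R s) ` (A \<times> T \<times> quad)"
  have W: "a + t *\<^sub>R s \<in> W" if "a \<in> A" "t \<in> T" "s \<in> quad" for a t s
    using that by (force simp: W_def)
  have "finite W"
    using A T by (simp add: W_def quad_def)
  \<comment> \<open>The points are enumerated because the vertices are to be natural
    numbers.\<close>
  then obtain g where "bij_betw g {0..<card W} W"
    using ex_bij_betw_nat_finite by blast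
  then have g: "inj_on g {..<card W}" "g ` {..<card W} = W"
    by (simp_all add: bij_betw_def lessThan_atLeast0)
  define G where "G = line_digraph g (card W)"
  have "\<not> partitionable_into m (\<lambda>S. acyclic_digraph (with_proj G \<restriction> S)) (verts (with_proj G))"
    if "m \<le> k" for m
  proof
    assume "partitionable_into m (\<lambda>S. acyclic_digraph (with_proj G \<restriction> S)) (verts (with_proj G))"
    then obtain X where X: "(\<Union>i<m. X i) = {..<card W}"
      and acyclic: "\<And>i. i < m \<Longrightarrow> acyclic_digraph (with_proj G \<restriction> X i)"
      by (auto simp: partitionable_into_def G_def)
    have "\<exists>i<m. \<exists>n. n < card W \<and> n \<in> X i \<and> g n = x" if "x \<in> W" for x
    proof -
      from that have "x \<in> g ` {..<card W}"
        by (simp only: g(2))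
      then obtain n where n: "n < card W" "g n = x"
        by auto
      then have "n \<in> (\<Union>i<m. X i)"
        using X by simp
      then show ?thesis
        using n by blast
    qed
    then have "\<forall>x\<in>W. \<exists>i n. i < m \<and> n < card W \<and> n \<in> X i \<and> g n = x"
      by blast
    \<comment> \<open>The part of a point becomes its colour \<open>col\<close>; \<open>ix\<close>
      inverts \<open>g\<close> on \<open>W\<close>.\<close>
    then obtain col ix where
      "\<forall>x\<in>W. col x < m \<and> ix x < card W \<and> ix x \<in> X (col x) \<and> g (ix x) = x"
      by (auto simp only: bchoice_iff)
    then have col: "\<And>x. x \<in> W \<Longrightarrow> col x < m"
      and ix: "\<And>x. x \<in> W \<Longrightarrow> ix x < card W" "\<And>x. x \<in> W \<Longrightarrow> ix x \<in> X (col x)"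
        "\<And>x. x \<in> W \<Longrightarrow> g (ix x) = x"
      by blast+
    obtain a t where a: "a \<in> A" and t: "t \<in> T"
      and mono: "\<And>s s'. s \<in> quad \<Longrightarrow> s' \<in> quad \<Longrightarrow> col (a + t *\<^sub>R s) = col (a + t *\<^sub>R s')"
    proof -
      \<comment> \<open>Gallai's theorem colours the whole space, so points off \<open>W\<close> get
        the default 0. It is a legal colour among \<open>Suc k\<close> even for \<open>k\<close> =
        0.\<close>
      define c where "c x = (if x \<in> W then col x else 0)" for x
      have "c x < Suc k" for x
        using col[of x] \<open>m \<le> k\<close> by (auto simp: c_def)
      from A_T[of c, OF this] obtain a t where a: "a \<in> A" and t: "t \<in> T"
        and mono: "\<forall>s\<in>quad. \<forall>s'\<in>quad. c (a + t *\<^sub>R s) = c (a + t *\<^sub>R s')"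
        by blast
      have "c (a + t *\<^sub>R s) = col (a + t *\<^sub>R s)" if "s \<in> quad" for s
        unfolding c_def using W[OF a t that] by (rule if_P)
      then show thesis
        using that[OF a t] mono by metis
    qed
    define P where "P s = a + t *\<^sub>R s" for s
    define j where "j = col (P (0, 0, 0))"
    have P: "P s \<in> W" if "s \<in> quad" for s
      using W a t that by (simp add: P_def)
    have j: "ix (P s) \<in> X j" if "s \<in> quad" for s
      using ix(2)[OF P[OF that]] mono[OF that, of "(0, 0, 0)"] by (simp add: j_def P_def quad_def)
    have "0 < t"
      using t T by auto
    then have arcs:
      "line_arc (P (0, 0, 0)) (P (1, 0, 0))" "line_arc (P (1, 0, 0)) (P (1, 1, 0))"
      "line_arc (P (1, 1, 0)) (P (1, 1, 1))" "line_arc (P (1, 1, 1)) (P (0, 0, 0))"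
      and dist: "distinct (map P [(0, 0, 0), (1, 0, 0), (1, 1, 0), (1, 1, 1)])"
      by (cases a; simp add: P_def)+
    have quad: "(0, 0, 0) \<in> quad" "(1, 0, 0) \<in> quad" "(1, 1, 0) \<in> quad" "(1, 1, 1) \<in> quad"
      by (auto simp: quad_def)
    \<comment> \<open>Distinct points have distinct indices, since \<open>g\<close> recovers the
      point from its index.\<close>
    have "distinct (map (\<lambda>s. ix (P s)) [(0, 0, 0), (1, 0, 0), (1, 1, 0), (1, 1, 1)])"
      using dist ix(3)[OF P] quad by (simp; metis)
    then have "\<not> acyclic_digraph (with_proj G \<restriction> X j)"
      using j quad arcs ix(1,3)[OF P]
      by (intro four_cycle_not_acyclic[of "ix (P (0, 0, 0))" "ix (P (1, 0, 0))"
            "ix (P (1, 1, 0))" "ix (P (1, 1, 1))"]) (simp_all add: G_def)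
    moreover have "j < m"
      using col P quad by (simp add: j_def)
    ultimately show False
      using acyclic by blast
  qed
  then have "k < dichromatic_number (with_proj G)"
    by (intro dichromatic_number_gtI[where N = "card W"])
       (simp_all add: G_def oriented_digraph_line_digraph)
  then show ?thesis
    using g(1) G_def by blast
qed

section \<open>The sequence of digraphs\<close>

theorem theorem2p3:
  shows "\<exists>F :: nat \<Rightarrow> nat pair_pre_digraph.
    (\<forall>n\<ge>1. oriented_digraph (with_proj (F n))) \<and>
    filterlim (\<lambda>n. dichromatic_number (with_proj (F n))) at_top sequentially \<and>
    (\<forall>n\<ge>1. \<forall>v\<in>pverts (F n).
       partitionable_into 4 (\<lambda>S. tournament (with_proj (F n) \<restriction> S))
         (neighbourhood (with_proj (F n)) v)) \<and>
    (\<forall>n\<ge>1. \<not> has_cyclic_triangle (with_proj (F n)))"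
proof -
  obtain g N where inj: "\<And>k. inj_on (g k) {..<N k}"
    and large: "\<And>k. k < dichromatic_number (with_proj (line_digraph (g k) (N k)))"
    using exists_line_digraph by metis
  define F where "F k = line_digraph (g k) (N k)" for k
  \<comment> \<open>The dichromatic number of \<open>F n\<close> exceeds \<open>n\<close>, so it
    dominates the identity.\<close>
  have "filterlim (\<lambda>n. dichromatic_number (with_proj (F n))) at_top sequentially"
    by (rule filterlim_at_top_mono[OF filterlim_ident])
       (simp add: F_def large less_imp_le)
  then show ?thesis
    using inj by (intro exI[of _ F])
      (simp add: F_def oriented_digraph_line_digraph no_cyclic_triangle_line_digraph
        neighbourhood_line_digraph)
qed

end
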